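(* Let $(X,T)$ be an IP$^*$-central dynamical system and $n\geq 2$. Then $(X,T)$ is $n$-tuplewise IP-sensitive if and only if there exists a constant $\delta>0$ with the property that for every non-empty open subset $U$ of $X$ there exist $x_1,\dots,x_{n-1}\in U$ and $y_1,\dots,y_{n-1}\in X$ with $\min_{1\le i<j\le n-1}d(y_i,y_j)>\delta$ and $\min_{1\le i\le n-1}d(x_i,y_i)>\delta$ such that $(x_1,\dots,x_{n-1})$ is strongly proximal to $(y_1,\dots,y_{n-1})$ in the $(n-1)$-fold product system $(X^{n-1},T^{(n-1)})$.
   Context: A dynamical system is a pair $(X,T)$ where $X$ is a compact metric space with metric $d$ and $T\colon X\to X$ is a continuous surjection. $\mathbb{N}$ is the set of positive integers. The $m$-fold product system is $(X^m,T^{(m)})$ with $T^{(m)}(x_1,\dots,x_m)=(Tx_1,\dots,Tx_m)$. A minimum over an empty index set imposes no condition (so for $n=2$ the condition on $d(y_i,y_j)$ is vacuous). A set $F\subset\mathbb{N}$ is an IP-set if there is a sequence $(p_i)_{i\ge1}$ in $\mathbb{N}$ such that $\sum_{i\in\alpha}p_i\in F$ for every non-empty finite $\alpha\subset\mathbb{N}$; it is an IP$^*$-set if it meets every IP-set. $(X,T)$ is IP$^*$-central if for every non-empty open $U\subset X$ the set $N(U,U)=\{k\in\mathbb{N}:U\cap T^{-k}U\neq\emptyset\}$ is an IP$^*$-set. For a point $x$, $\omega(x,T)$ denotes the set of limit points of the sequence $(T^kx)_{k\ge 1}$, i.e. of all limits of $T^{k_i}x$ with $k_i\to\infty$. In a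 system $(X,T)$, $x$ is strongly proximal to $y$ if $(y,y)\in\omega((x,y),T\times T)$; this definition is applied to the system $(X^{n-1},T^{(n-1)})$. $(X,T)$ is $n$-tuplewise IP-sensitive if there is a constant $\delta>0$ such that for every non-empty open $U\subset X$ there exist $x_1,\dots,x_n\in U$ such that $\{k\in\mathbb{N}: \min_{1\le i<j\le n}d(T^kx_i,T^kx_j)>\delta\}$ is an IP-set. *)

theory Defs
  imports "HOL-Analysis.Analysis"
begin

text \<open>The phase space is a compact subset \<open>X\<close> of a metric space type, with its subspace topology
  and the metric \<open>dist\<close>.\<close>

definition dynamical_system :: "'a::metric_space set \<Rightarrow> ('a \<Rightarrow> 'a) \<Rightarrow> bool" where
  "dynamical_system X T \<longleftrightarrow> compact X \<and> continuous_on X T \<and> T ` X = X"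

text \<open>The natural numbers start at 1 here, both as elements of the sets below and as indices.\<close>

definition IP_set :: "nat set \<Rightarrow> bool" where
  "IP_set F \<longleftrightarrow> F \<subseteq> {1..} \<and>
     (\<exists>p :: nat \<Rightarrow> nat. (\<forall>i\<ge>1. p i \<ge> 1) \<and>
        (\<forall>\<alpha>. finite \<alpha> \<and> \<alpha> \<noteq> {} \<and> \<alpha> \<subseteq> {1..} \<longrightarrow> (\<Sum>i\<in>\<alpha>. p i) \<in> F))"

definition IP_star_set :: "nat set \<Rightarrow> bool" where
  "IP_star_set F \<longleftrightarrow> F \<subseteq> {1..} \<and> (\<forall>G. IP_set G \<longrightarrow> F \<inter> G \<noteq> {})"

definition return_times :: "'a set \<Rightarrow> ('a \<Rightarrow> 'a) \<Rightarrow> 'a set \<Rightarrow> 'a set \<Rightarrow> nat set" where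
  "return_times X T U V = {k. k \<ge> 1 \<and> U \<inter> {x \<in> X. (T ^^ k) x \<in> V} \<noteq> {}}"

definition IP_star_central :: "'a::metric_space set \<Rightarrow> ('a \<Rightarrow> 'a) \<Rightarrow> bool" where
  "IP_star_central X T \<longleftrightarrow>
     (\<forall>U. openin (top_of_set X) U \<and> U \<noteq> {} \<longrightarrow> IP_star_set (return_times X T U U))"

text \<open>The following notions take the topology of the phase space as an argument, so that they apply
  to product systems. Only the topology matters for them.\<close>

definition omega_limit :: "'b topology \<Rightarrow> ('b \<Rightarrow> 'b) \<Rightarrow> 'b \<Rightarrow> 'b set" where
  "omega_limit \<T> S x =
     {y. \<exists>k :: nat \<Rightarrow> nat. filterlim k at_top sequentially \<and>
           limitin \<T> (\<lambda>i. (S ^^ k i) x) y sequentially}"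

definition strongly_proximal :: "'b topology \<Rightarrow> ('b \<Rightarrow> 'b) \<Rightarrow> 'b \<Rightarrow> 'b \<Rightarrow> bool" where
  "strongly_proximal \<T> S x y \<longleftrightarrow> (y, y) \<in> omega_limit (prod_topology \<T> \<T>) (map_prod S S) (x, y)"

text \<open>The points of the \<open>m\<close>-fold product are the functions in \<open>{1..m} \<rightarrow>\<^sub>E X\<close>, which are
  \<open>undefined\<close> outside \<open>{1..m}\<close>; the product map has to preserve this, hence the restriction.\<close>

definition power_top :: "nat \<Rightarrow> 'a::metric_space set \<Rightarrow> (nat \<Rightarrow> 'a) topology" where
  "power_top m X = product_topology (\<lambda>_. top_of_set X) {1..m}"

definition power_map :: "nat \<Rightarrow> ('a \<Rightarrow> 'a) \<Rightarrow> (nat \<Rightarrow> 'a) \<Rightarrow> (nat \<Rightarrow> 'a)" where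
  "power_map m T x = (\<lambda>i\<in>{1..m}. T (x i))"

definition tuplewise_IP_sensitive :: "nat \<Rightarrow> 'a::metric_space set \<Rightarrow> ('a \<Rightarrow> 'a) \<Rightarrow> bool" where
  "tuplewise_IP_sensitive n X T \<longleftrightarrow>
     (\<exists>\<delta>>0. \<forall>U. openin (top_of_set X) U \<and> U \<noteq> {} \<longrightarrow>
        (\<exists>x \<in> {1..n} \<rightarrow>\<^sub>E U.
           IP_set {k. k \<ge> 1 \<and>
             (\<forall>i\<in>{1..n}. \<forall>j\<in>{1..n}. i < j \<longrightarrow> dist ((T ^^ k) (x i)) ((T ^^ k) (x j)) > \<delta>)}))"

end

theory Submission
  imports Defs
begin

text \<open>
  If \<open>{k. T\<^sup>k x\<^sub>i, T\<^sup>k x\<^sub>j \<delta>-separated}\<close> contains the finite sums of a sequence \<open>p\<close>, then the limits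
  of \<open>T\<^sup>k\<close> along finite sums of tails of \<open>p\<close> form a compact right topological semigroup, which has
  an idempotent \<open>u\<close>. The tuple \<open>x\<close> is strongly proximal to \<open>u x\<close>, whose entries are still
  separated. As the \<open>x\<^sub>i\<close> are close together, at most one \<open>u x\<^sub>i\<close> can be close to \<open>x\<^sub>i\<close>; this
  index is dropped.

  Conversely, strong proximality makes \<open>T\<^sup>k x\<^sub>i\<close> close to \<open>y\<^sub>i\<close> for all \<open>k\<close> in an IP-set, and the
  IP\<open>\<^sup>*\<close> return times provide one more point whose orbit stays near the \<open>x\<^sub>i\<close> along a
  sub-IP-set.
\<close>

section \<open>Idempotents in compact right topological semigroups\<close>

text \<open>By Zorn there is a minimal closed non-empty subsemigroup M. For e in M the set Me is
  again one, so Me = M. Hence the a in M with ae = e form a non-empty closed subsemigroup, which by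
  minimality is M, and ee = e follows.\<close>

lemma Ellis_Namakura:
  assumes "compact_space \<tau>" and "Hausdorff_space \<tau>"
    and S: "closedin \<tau> S" "S \<noteq> {}"
    and mult: "\<And>a b. a \<in> S \<Longrightarrow> b \<in> S \<Longrightarrow> f a b \<in> S"
    and assoc: "\<And>a b c. a \<in> S \<Longrightarrow> b \<in> S \<Longrightarrow> c \<in> S \<Longrightarrow> f (f a b) c = f a (f b c)"
    and cont: "\<And>a. a \<in> S \<Longrightarrow> continuous_map \<tau> \<tau> (\<lambda>x. f x a)"
  obtains e where "e \<in> S" "f e e = e"
proof -
  define \<A> where "\<A> = {M. M \<subseteq> S \<and> M \<noteq> {} \<and> closedin \<tau> M \<and> (\<forall>a\<in>M. \<forall>b\<in>M. f a b \<in> M)}"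
  have "\<exists>M\<in>\<A>. \<forall>N\<in>\<A>. N \<subseteq> M \<longrightarrow> N = M"
  \<comment> \<open>With inclusion reversed, maximal elements are minimal sets, and the bound for a
    chain is its intersection, non-empty by the finite intersection property.\<close>
  proof (rule predicate_Zorn)
    show "partial_order_on \<A> (relation_of (\<lambda>M N. N \<subseteq> M) \<A>)"
      by (rule partial_order_on_relation_ofI) auto
  next
    fix C assume "C \<in> Chains (relation_of (\<lambda>M N. N \<subseteq> M) \<A>)"
    then have C: "C \<subseteq> \<A>" and chain: "\<And>M N. M \<in> C \<Longrightarrow> N \<in> C \<Longrightarrow> M \<subseteq> N \<or> N \<subseteq> M"
      by (auto simp: Chains_def relation_of_def)
    show "\<exists>u\<in>\<A>. \<forall>a\<in>C. u \<subseteq> a"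
    proof (cases "C = {}")
      case True
      then show ?thesis using S mult by (auto simp: \<A>_def)
    next
      case False
      have "\<exists>M\<in>C. M \<subseteq> \<Inter>\<F>" if "finite \<F>" "\<F> \<subseteq> C" for \<F>
        using that
      proof (induction \<F>)
        case empty
        then show ?case using False by auto
      next
        case (insert A \<F>)
        then obtain M where "M \<in> C" "M \<subseteq> \<Inter>\<F>" "A \<in> C" by auto
        with chain[of M A] show ?case by auto
      qed
      moreover have "M \<noteq> {}" if "M \<in> C" for M using that C by (auto simp: \<A>_def)
      ultimately have "\<Inter>\<F> \<noteq> {}" if "finite \<F>" "\<F> \<subseteq> C" for \<F>
        using that by (metis subset_empty)
      moreover have "\<forall>M\<in>C. closedin \<tau> M" using C by (auto simp: \<A>_def)
      ultimately have ne: "\<Inter>C \<noteq> {}"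
        using assms(1) unfolding compact_space_fip by simp
      have "closedin \<tau> (\<Inter>C)"
        using False \<open>\<forall>M\<in>C. closedin \<tau> M\<close> by (simp add: closedin_Inter)
      moreover have "\<Inter>C \<subseteq> S" using False C unfolding \<A>_def by fast
      moreover have "f a b \<in> M" if "a \<in> \<Inter>C" "b \<in> \<Inter>C" "M \<in> C" for a b M
        using that C by (auto simp: \<A>_def)
      ultimately have "\<Inter>C \<in> \<A>"
        using ne by (simp add: \<A>_def)
      then show ?thesis by auto
    qed
  qed
  then obtain M where M: "M \<in> \<A>" and min: "\<And>N. N \<in> \<A> \<Longrightarrow> N \<subseteq> M \<Longrightarrow> N = M"
    by blast
  have MS: "M \<subseteq> S" and Mcl: "closedin \<tau> M" and Mm: "\<And>a b. a \<in> M \<Longrightarrow> b \<in> M \<Longrightarrow> f a b \<in> M"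
    using M by (auto simp: \<A>_def)
  obtain e where e: "e \<in> M" using M by (auto simp: \<A>_def)
  have eS: "e \<in> S" using e MS by auto
  \<comment> \<open>Me is closed as a compact image in a Hausdorff space, and (ae)(be) = ((ae)b)e
    keeps it closed under multiplication.\<close>
  have "(\<lambda>x. f x e) ` M \<in> \<A>"
  proof -
    have "compactin \<tau> M"
      using Mcl \<open>compact_space \<tau>\<close> closedin_compact_space by blast
    then have "closedin \<tau> ((\<lambda>x. f x e) ` M)"
      using cont[OF eS] image_compactin \<open>Hausdorff_space \<tau>\<close> compactin_imp_closedin by blast
    moreover have "f (f a e) (f b e) \<in> (\<lambda>x. f x e) ` M" if "a \<in> M" "b \<in> M" for a b
    proof -
      have "f (f a e) (f b e) = f (f (f a e) b) e"
        using assoc[of "f a e" b e] that e Mm MS by (simp add: subset_iff)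
      then show ?thesis using that e Mm by blast
    qed
    ultimately show ?thesis using Mm MS e unfolding \<A>_def by blast
  qed
  then have Me: "(\<lambda>x. f x e) ` M = M"
    using min Mm e by blast
  define N where "N = {a \<in> M. f a e = e}"
  have "N \<noteq> {}"
    using Me e unfolding N_def by (metis (mono_tags, lifting) empty_iff image_iff mem_Collect_eq)
  moreover have "closedin \<tau> N"
  proof -
    have "e \<in> topspace \<tau>" using eS S(1) closedin_subset by blast
    then have "closedin \<tau> {e}"
      by (simp add: \<open>Hausdorff_space \<tau>\<close> closedin_Hausdorff_singleton)
    then have "closedin \<tau> {a \<in> topspace \<tau>. f a e \<in> {e}}"
      by (rule closedin_continuous_map_preimage[OF cont[OF eS]])
    then have "closedin \<tau> (M \<inter> {a \<in> topspace \<tau>. f a e \<in> {e}})"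
      using Mcl by blast
    moreover have "N = M \<inter> {a \<in> topspace \<tau>. f a e \<in> {e}}"
      using Mcl closedin_subset unfolding N_def by blast
    ultimately show ?thesis by simp
  qed
  moreover have "f a b \<in> N" if "a \<in> N" "b \<in> N" for a b
    using that assoc[of a b e] MS Mm eS unfolding N_def by auto
  ultimately have "N \<in> \<A>" using MS unfolding \<A>_def N_def by blast
  then have "N = M" by (rule min) (auto simp: N_def)
  with e that[OF eS] show thesis unfolding N_def by blast
qed

section \<open>Iterates and strong proximality\<close>

lemma funpow_mem:
  assumes "T ` X \<subseteq> X" and "x \<in> X" shows "(T ^^ k) x \<in> X"
proof (induction k)
  case (Suc k)
  with assms(1) have "T ((T ^^ k) x) \<in> X" by blast
  then show ?case by simp
qed (simp add: assms(2))

lemma continuous_on_funpow: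
  assumes "continuous_on X T" and "T ` X \<subseteq> X"
  shows "continuous_on X (T ^^ k)"
proof (induction k)
  case (Suc k)
  have "(T ^^ k) ` X \<subseteq> X" using funpow_mem[OF assms(2)] by (rule image_subsetI)
  then show ?case
    using Suc continuous_on_compose[of X "T ^^ k" T] continuous_on_subset[OF assms(1)] by simp
qed (simp add: id_def)

text \<open>Extensionality matters at k = 0: the zeroth iterate returns x unchanged, while the
  right-hand side is \<open>undefined\<close> outside \<open>{1..m}\<close>.\<close>

lemma power_map_funpow:
  assumes "x \<in> extensional {1..m}"
  shows "(power_map m T ^^ k) x = (\<lambda>i\<in>{1..m}. (T ^^ k) (x i))"
proof (induction k)
  case 0
  then show ?case using assms by (simp add: extensional_restrict)
qed (auto simp: power_map_def)

lemma map_prod_funpow: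
  fixes f :: "'a \<Rightarrow> 'a" and g :: "'b \<Rightarrow> 'b"
  shows "(map_prod f g ^^ k) (x, y) = ((f ^^ k) x, (g ^^ k) y)"
  by (induction k) auto

lemma limitin_power_top:
  assumes T: "T ` X \<subseteq> X" and x: "x \<in> {1..m} \<rightarrow>\<^sub>E X" and y: "y \<in> {1..m} \<rightarrow>\<^sub>E X"
  shows "limitin (power_top m X) (\<lambda>j. (power_map m T ^^ k j) x) y sequentially \<longleftrightarrow>
    (\<forall>i\<in>{1..m}. (\<lambda>j. (T ^^ k j) (x i)) \<longlonglongrightarrow> y i)"
proof -
  have *: "(power_map m T ^^ k j) x = (\<lambda>i\<in>{1..m}. (T ^^ k j) (x i))" for j
    using x by (intro power_map_funpow) (auto simp: PiE_def)
  have "(T ^^ k j) (x i) \<in> X" if "i \<in> {1..m}" for i j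
    using funpow_mem[OF T] x that by blast
  then show ?thesis
    using y unfolding power_top_def * limitin_componentwise
    by (auto simp: limitin_subtopology PiE_def)
qed

text \<open>This is the form in which both implications handle strong proximality: as there are
  finitely many coordinates, one time k serves all of them. The sequence of times is recovered by
  taking N = j and error 1/(j+1) at stage j.\<close>

lemma strongly_proximal_power_iff:
  assumes T: "T ` X \<subseteq> X" and x: "x \<in> {1..m} \<rightarrow>\<^sub>E X" and y: "y \<in> {1..m} \<rightarrow>\<^sub>E X"
  shows "strongly_proximal (power_top m X) (power_map m T) x y \<longleftrightarrow>
    (\<forall>\<epsilon>>0. \<forall>N. \<exists>k\<ge>N. \<forall>i\<in>{1..m}. dist ((T ^^ k) (x i)) (y i) < \<epsilon> \<and> dist ((T ^^ k) (y i)) (y i) < \<epsilon>)"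
    (is "?L \<longleftrightarrow> ?R")
proof -
  have L: "?L \<longleftrightarrow> (\<exists>k :: nat \<Rightarrow> nat. filterlim k at_top sequentially \<and>
      (\<forall>i\<in>{1..m}. (\<lambda>j. (T ^^ k j) (x i)) \<longlonglongrightarrow> y i) \<and> (\<forall>i\<in>{1..m}. (\<lambda>j. (T ^^ k j) (y i)) \<longlonglongrightarrow> y i))"
    unfolding strongly_proximal_def omega_limit_def limitin_pairwise
    by (simp add: map_prod_funpow comp_def limitin_power_top[OF T x y] limitin_power_top[OF T y y])
  show ?thesis
  proof
    assume ?L
    then obtain k :: "nat \<Rightarrow> nat" where k: "filterlim k at_top sequentially"
      and lim: "\<And>i. i \<in> {1..m} \<Longrightarrow> (\<lambda>j. (T ^^ k j) (x i)) \<longlonglongrightarrow> y i"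
        "\<And>i. i \<in> {1..m} \<Longrightarrow> (\<lambda>j. (T ^^ k j) (y i)) \<longlonglongrightarrow> y i"
      unfolding L by blast
    show ?R
    proof (intro allI impI)
      fix \<epsilon> :: real and N :: nat assume "\<epsilon> > 0"
      then have "\<forall>\<^sub>F j in sequentially. k j \<ge> N \<and>
          (\<forall>i\<in>{1..m}. dist ((T ^^ k j) (x i)) (y i) < \<epsilon> \<and> dist ((T ^^ k j) (y i)) (y i) < \<epsilon>)"
        using k lim by (auto intro!: eventually_conj eventually_ball_finite tendstoD
            simp: filterlim_at_top)
      then show "\<exists>k\<ge>N. \<forall>i\<in>{1..m}. dist ((T ^^ k) (x i)) (y i) < \<epsilon> \<and> dist ((T ^^ k) (y i)) (y i) < \<epsilon>"
        by (auto simp: eventually_sequentially)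
    qed
  next
    assume ?R
    then have "\<forall>j. \<exists>k\<ge>j. \<forall>i\<in>{1..m}. dist ((T ^^ k) (x i)) (y i) < inverse (Suc j) \<and>
        dist ((T ^^ k) (y i)) (y i) < inverse (Suc j)"
      by (simp del: of_nat_Suc)
    then obtain k where k: "\<And>j. k j \<ge> j"
      and d: "\<And>i j. i \<in> {1..m} \<Longrightarrow> dist ((T ^^ k j) (x i)) (y i) < inverse (Suc j)"
        "\<And>i j. i \<in> {1..m} \<Longrightarrow> dist ((T ^^ k j) (y i)) (y i) < inverse (Suc j)"
      by metis
    have conv: "f \<longlonglongrightarrow> l" if "\<And>j. dist (f j) l < inverse (Suc j)" for f :: "nat \<Rightarrow> 'a" and l
    proof (rule metric_tendsto_imp_tendsto[OF LIMSEQ_inverse_real_of_nat])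
      show "\<forall>\<^sub>F j in sequentially. dist (f j) l \<le> dist (inverse (real (Suc j))) 0"
        using that by (intro always_eventually) (simp add: less_imp_le)
    qed
    have "filterlim k at_top sequentially"
      using k by (intro filterlim_at_top_mono[OF filterlim_ident]) auto
    moreover have "\<forall>i\<in>{1..m}. (\<lambda>j. (T ^^ k j) (x i)) \<longlonglongrightarrow> y i" "\<forall>i\<in>{1..m}. (\<lambda>j. (T ^^ k j) (y i)) \<longlonglongrightarrow> y i"
      using d by (auto intro!: conv)
    ultimately show ?L
      unfolding L by blast
  qed
qed

section \<open>Idempotent limits along finite sums\<close>

text \<open>The pointwise limits of \<open>T ^^ k\<close>, with k running through finite sums of
  ever later tails of p, form a compact semigroup under composition, because sums over disjoint
  index sets add up to such sums. Its idempotent is u, and the last conclusion says that u is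
  approximated on finite sets by \<open>T ^^ k\<close> with k a large finite sum.\<close>

lemma IP_idempotent_limit:
  fixes X :: "'a::metric_space set" and p :: "nat \<Rightarrow> nat"
  assumes X: "compact X" and cont: "continuous_on X T" and T: "T ` X \<subseteq> X"
    and p: "\<forall>i\<ge>1. p i \<ge> 1"
  obtains u where "\<forall>z\<in>X. u z \<in> X" "\<forall>z\<in>X. u (u z) = u z"
    "\<forall>F \<epsilon> N. finite F \<and> F \<subseteq> X \<and> \<epsilon> > 0 \<longrightarrow>
      (\<exists>\<alpha>. finite \<alpha> \<and> \<alpha> \<noteq> {} \<and> \<alpha> \<subseteq> {1..} \<and> sum p \<alpha> \<ge> N \<and> (\<forall>z\<in>F. dist ((T ^^ sum p \<alpha>) z) (u z) < \<epsilon>))"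
proof -
  \<comment> \<open>The topology of pointwise convergence on the self-maps of X; compactness is
    Tychonoff's theorem.\<close>
  define \<tau> where "\<tau> = product_topology (\<lambda>_. top_of_set X) X"
  define t where "t k = restrict (T ^^ k) X" for k
  \<comment> \<open>The bound on the indices makes room for disjoint sums; the bound on the value
    later gives \<open>sum p \<alpha> \<ge> N\<close>. Starting at \<open>Suc m\<close> keeps the
    indices positive even for m = 0.\<close>
  define A where "A m = {sum p \<alpha> |\<alpha>. finite \<alpha> \<and> \<alpha> \<noteq> {} \<and> \<alpha> \<subseteq> {Suc m..} \<and> sum p \<alpha> \<ge> m}" for m
  define C where "C m = \<tau> closure_of (t ` A m)" for m
  define S where "S = (\<Inter>m. C m)"
  have top: "topspace \<tau> = X \<rightarrow>\<^sub>E X" by (simp add: \<tau>_def)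
  have t_top: "t k \<in> topspace \<tau>" for k
    using funpow_mem[OF T] by (auto simp: top t_def)
  have cpt: "compact_space \<tau>"
    using X unfolding \<tau>_def compact_space_product_topology by (simp add: compact_space_subtopology)
  have Haus: "Hausdorff_space \<tau>"
    unfolding \<tau>_def Hausdorff_space_product_topology by (simp add: Hausdorff_space_subtopology)
  have A_ne: "A m \<noteq> {}" for m
  proof -
    \<comment> \<open>The interval has m + 1 indices, each contributing at least 1, so the value
      exceeds m.\<close>
    have "(\<Sum>i\<in>{Suc m..Suc (2*m)}. 1) \<le> sum p {Suc m..Suc (2*m)}"
      by (rule sum_mono) (use p in auto)
    then have "sum p {Suc m..Suc (2*m)} \<in> A m"
      unfolding A_def by (intro CollectI exI[of _ "{Suc m..Suc (2*m)}"]) auto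
    then show ?thesis by auto
  qed
  have A_dec: "A m' \<subseteq> A m" if "m \<le> m'" for m m'
  proof
    fix k assume "k \<in> A m'"
    then obtain \<alpha> where \<alpha>: "k = sum p \<alpha>" "finite \<alpha>" "\<alpha> \<noteq> {}" "\<alpha> \<subseteq> {Suc m'..}" "k \<ge> m'"
      by (auto simp: A_def)
    moreover have "\<alpha> \<subseteq> {Suc m..}" using \<alpha>(4) that by (force simp: subset_iff)
    ultimately show "k \<in> A m" using that by (auto simp: A_def)
  qed
  have "S \<noteq> {}"
    unfolding S_def
  proof (rule compact_space_imp_nest[OF cpt])
    show "C m \<noteq> {}" for m
    proof -
      have "t ` A m \<subseteq> C m" unfolding C_def using t_top by (intro closure_of_subset) auto
      then show ?thesis using A_ne[of m] by auto
    qed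
    show "decseq C"
      unfolding C_def decseq_def using A_dec by (intro allI impI closure_of_mono image_mono) auto
  qed (simp add: C_def)
  moreover have "closedin \<tau> S" unfolding S_def C_def by auto
  moreover have S_top: "S \<subseteq> topspace \<tau>"
    unfolding S_def C_def using closure_of_subset_topspace by fastforce
  \<comment> \<open>Coordinate z of the result is coordinate \<open>v z\<close> of f: a projection,
    hence continuous for every self-map v of X.\<close>
  have R_cont: "continuous_map \<tau> \<tau> (\<lambda>f. compose X f v)" if "v \<in> topspace \<tau>" for v
  proof -
    have "continuous_map \<tau> (top_of_set X) (\<lambda>f. f (v z))" if "z \<in> X" for z
      unfolding \<tau>_def using \<open>v \<in> topspace \<tau>\<close> that
      by (intro continuous_map_product_projection) (auto simp: top)
    then show ?thesis
      unfolding \<tau>_def continuous_map_componentwise by (auto simp: compose_def)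
  qed
  \<comment> \<open>Composition on the left is continuous here because each \<open>T ^^ k\<close>
    is; elements of S may be discontinuous maps.\<close>
  have L_cont: "continuous_map \<tau> \<tau> (\<lambda>f. compose X (t k) f)" for k
  proof -
    have tk: "continuous_map (top_of_set X) (top_of_set X) (t k)"
      using continuous_on_funpow[OF cont T, of k] funpow_mem[OF T]
      by (auto simp: t_def continuous_map_in_subtopology)
    have "continuous_map \<tau> (top_of_set X) (\<lambda>f. t k (f z))" if "z \<in> X" for z
    proof -
      have "continuous_map \<tau> (top_of_set X) (\<lambda>f. f z)"
        unfolding \<tau>_def using that by (rule continuous_map_product_projection)
      from continuous_map_compose[OF this tk] show ?thesis by (simp add: comp_def)
    qed
    then show ?thesis
      unfolding \<tau>_def continuous_map_componentwise by (auto simp: compose_def)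
  qed
  \<comment> \<open>Two limits in succession: for fixed k in \<open>A m\<close>, continuity on the
    left puts \<open>compose X (t k) v\<close> into \<open>C m\<close>; then \<open>t k\<close>
    approaches u, by continuity on the right.\<close>
  have mult: "compose X u v \<in> S" if u: "u \<in> S" and v: "v \<in> S" for u v
    unfolding S_def
  proof
    fix m
    have "compose X (t k) v \<in> C m" if k: "k \<in> A m" for k
    proof -
      obtain \<alpha> where \<alpha>: "k = sum p \<alpha>" "finite \<alpha>" "\<alpha> \<noteq> {}" "\<alpha> \<subseteq> {Suc m..}" "k \<ge> m"
        using k by (auto simp: A_def)
      \<comment> \<open>Index sets beyond \<open>Max \<alpha>\<close> are disjoint from \<alpha>, so
        k + j is the sum of p over the union.\<close>
      have "compose X (t k) ` t ` A (Max \<alpha>) \<subseteq> t ` A m"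
      proof safe
        fix j assume "j \<in> A (Max \<alpha>)"
        then obtain \<beta> where \<beta>: "j = sum p \<beta>" "finite \<beta>" "\<beta> \<noteq> {}" "\<beta> \<subseteq> {Suc (Max \<alpha>)..}"
          by (auto simp: A_def)
        have "i \<le> Max \<alpha>" if "i \<in> \<alpha>" for i using \<alpha>(2) that by simp
        moreover have "Max \<alpha> < i" if "i \<in> \<beta>" for i using \<beta>(4) that by auto
        ultimately have "\<alpha> \<inter> \<beta> = {}" by fastforce
        then have "k + j = sum p (\<alpha> \<union> \<beta>)" using \<alpha> \<beta> by (simp add: sum.union_disjoint)
        moreover have "Max \<alpha> \<ge> Suc m" using \<alpha> by (meson Max_in atLeast_iff subsetD)
        then have "\<beta> \<subseteq> {Suc m..}" using \<beta>(4) by (force simp: subset_iff)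
        ultimately have "k + j \<in> A m"
          unfolding A_def using \<alpha> \<beta>(2) by (intro CollectI exI[of _ "\<alpha> \<union> \<beta>"]) auto
        moreover have "compose X (t k) (t j) = t (k + j)"
          using funpow_mem[OF T] by (auto simp: compose_def t_def funpow_add)
        ultimately show "compose X (t k) (t j) \<in> t ` A m" by auto
      qed
      moreover have "v \<in> \<tau> closure_of (t ` A (Max \<alpha>))" using v by (auto simp: S_def C_def)
      ultimately show ?thesis
        using continuous_map_image_closure_subset[OF L_cont[of k], of "t ` A (Max \<alpha>)"]
          closure_of_mono[of "compose X (t k) ` t ` A (Max \<alpha>)" "t ` A m" \<tau>]
        unfolding C_def by blast
    qed
    then have "(\<lambda>f. compose X f v) ` t ` A m \<subseteq> C m" by auto
    then have "\<tau> closure_of ((\<lambda>f. compose X f v) ` t ` A m) \<subseteq> C m"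
      by (rule closure_of_minimal) (simp add: C_def)
    moreover have "u \<in> \<tau> closure_of (t ` A m)" using u by (auto simp: S_def C_def)
    ultimately show "compose X u v \<in> C m"
      using continuous_map_image_closure_subset[OF R_cont[of v], of "t ` A m"] v S_top by blast
  qed
  ultimately obtain u where u: "u \<in> S" "compose X u u = u"
  proof (rule_tac Ellis_Namakura[OF cpt Haus, of S "compose X"])
    show "compose X (compose X a b) c = compose X a (compose X b c)"
      if "a \<in> S" "b \<in> S" "c \<in> S" for a b c
      using that S_top unfolding top by (intro compose_assoc[symmetric, of _ X X]) auto
    show "continuous_map \<tau> \<tau> (\<lambda>x. compose X x a)" if "a \<in> S" for a
      using R_cont that S_top by blast
  qed (use mult in auto)
  have uX: "u z \<in> X" if "z \<in> X" for z
    using u(1) S_top that by (auto simp: top)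
  show thesis
  proof (rule that[of u])
    show "\<forall>z\<in>X. u (u z) = u z"
      using fun_cong[OF u(2)] by (metis compose_eq)
    show "\<forall>F \<epsilon> N. finite F \<and> F \<subseteq> X \<and> \<epsilon> > 0 \<longrightarrow>
      (\<exists>\<alpha>. finite \<alpha> \<and> \<alpha> \<noteq> {} \<and> \<alpha> \<subseteq> {1..} \<and> sum p \<alpha> \<ge> N \<and> (\<forall>z\<in>F. dist ((T ^^ sum p \<alpha>) z) (u z) < \<epsilon>))"
    proof (intro allI impI)
      fix F :: "'a set" and \<epsilon> :: real and N :: nat
      assume "finite F \<and> F \<subseteq> X \<and> \<epsilon> > 0"
      then have F: "finite F" "F \<subseteq> X" "\<epsilon> > 0" by auto
      define V where "V = (\<Pi>\<^sub>E z\<in>X. if z \<in> F then X \<inter> ball (u z) \<epsilon> else X)"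
      have "openin \<tau> V"
        unfolding \<tau>_def V_def openin_PiE_gen
        using F(1) by (auto intro: finite_subset[of _ F] openin_open_Int)
      moreover have "u \<in> V"
        using uX u(1) S_top F by (auto simp: V_def top PiE_iff)
      moreover have "u \<in> \<tau> closure_of (t ` A N)" using u by (auto simp: S_def C_def)
      ultimately obtain k where k: "k \<in> A N" "t k \<in> V"
        unfolding in_closure_of by blast
      have "dist ((T ^^ k) z) (u z) < \<epsilon>" if "z \<in> F" for z
      proof -
        have "t k z \<in> (if z \<in> F then X \<inter> ball (u z) \<epsilon> else X)"
          using k(2) that F unfolding V_def by (blast dest: PiE_mem)
        then show ?thesis using that F by (auto simp: t_def dist_commute)
      qed
      with k(1) show "\<exists>\<alpha>. finite \<alpha> \<and> \<alpha> \<noteq> {} \<and> \<alpha> \<subseteq> {1..} \<and> sum p \<alpha> \<ge> N \<and> (\<forall>z\<in>F. dist ((T ^^ sum p \<alpha>) z) (u z) < \<epsilon>)"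
        unfolding A_def by fastforce
    qed
  qed (use uX in auto)
qed

section \<open>Nested neighbourhoods and finite sums\<close>

text \<open>Apply the times from the largest index down. After the indices in \<beta> the point is
  in \<open>W (Min \<beta>)\<close>, which lies in \<open>W (Suc b)\<close> for every smaller b, so
  \<open>q b\<close> moves it into \<open>W b\<close>.\<close>

lemma funpow_sum_nested:
  fixes q :: "nat \<Rightarrow> nat"
  assumes step: "\<And>k z. z \<in> W (Suc k) \<Longrightarrow> (T ^^ q k) z \<in> W k"
    and dec: "decseq W"
    and start: "\<And>k. (T ^^ q k) z \<in> W k"
    and "finite \<alpha>" "\<alpha> \<noteq> {}"
  shows "(T ^^ sum q \<alpha>) z \<in> W 0"
proof -
  have "(T ^^ sum q \<alpha>) z \<in> W (Min \<alpha>)" if "\<alpha> \<noteq> {}"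
    using \<open>finite \<alpha>\<close> that
  proof (induction rule: finite_linorder_min_induct)
    case (insert b \<beta>)
    show ?case
    proof (cases "\<beta> = {}")
      case True
      then show ?thesis using start by simp
    next
      case False
      then have "Suc b \<le> Min \<beta>" using insert by (auto simp: Suc_le_eq)
      then have "(T ^^ sum q \<beta>) z \<in> W (Suc b)"
        using insert False dec unfolding decseq_def by blast
      then have "(T ^^ q b) ((T ^^ sum q \<beta>) z) \<in> W b" by (rule step)
      moreover have "b \<notin> \<beta>" using insert by auto
      moreover have "Min (insert b \<beta>) = b"
        using insert by (intro Min_eqI) (auto simp: less_imp_le)
      ultimately show ?thesis using insert by (simp add: funpow_add)
    qed
  qed simp
  with assms show ?thesis unfolding decseq_def by blast
qed

text \<open>Choose radii \<open>E n\<close> and times \<open>p n\<close> alternately: proximality at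
  scale \<open>E n\<close> gives a time, and continuity at the points y i gives a radius
  \<open>E (Suc n)\<close> whose balls this time maps into the balls of radius \<open>E n\<close>.
  These nested balls are the W of \<open>funpow_sum_nested\<close>, and the same times serve all
  i.\<close>

lemma proximal_IP:
  fixes X :: "'a::metric_space set" and x y :: "'i \<Rightarrow> 'a"
  assumes cont: "continuous_on X T" and T: "T ` X \<subseteq> X" and I: "finite I"
    and x: "\<And>i. i \<in> I \<Longrightarrow> x i \<in> X" and y: "\<And>i. i \<in> I \<Longrightarrow> y i \<in> X"
    and prox: "\<And>\<epsilon>. \<epsilon> > 0 \<Longrightarrow>
      \<exists>k\<ge>1. \<forall>i\<in>I. dist ((T ^^ k) (x i)) (y i) < \<epsilon> \<and> dist ((T ^^ k) (y i)) (y i) < \<epsilon>"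
    and "\<epsilon> > 0"
  obtains p :: "nat \<Rightarrow> nat" where "\<And>i. p i \<ge> 1"
    "\<And>\<alpha> i. finite \<alpha> \<Longrightarrow> \<alpha> \<noteq> {} \<Longrightarrow> i \<in> I \<Longrightarrow> dist ((T ^^ sum p \<alpha>) (x i)) (y i) < \<epsilon>"
proof -
  define G where "G k e e' \<longleftrightarrow> 0 < e' \<and> e' \<le> e \<and> k \<ge> 1 \<and> (\<forall>i\<in>I. dist ((T ^^ k) (x i)) (y i) < e \<and>
      (\<forall>z\<in>X. dist z (y i) < e' \<longrightarrow> dist ((T ^^ k) z) (y i) < e))" for k :: nat and e e' :: real
  have "\<exists>e'>0. \<exists>k. G k e e'" if e: "e > 0" for e
  proof -
    obtain k where k: "k \<ge> 1" "\<forall>i\<in>I. dist ((T ^^ k) (x i)) (y i) < e \<and> dist ((T ^^ k) (y i)) (y i) < e"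
      using prox[OF e] by auto
    have "\<forall>i\<in>I. \<exists>d>0. \<forall>z\<in>X. dist z (y i) < d \<longrightarrow> dist ((T ^^ k) z) (y i) < e"
    proof
      fix i assume i: "i \<in> I"
      then have "e - dist ((T ^^ k) (y i)) (y i) > 0" using k by auto
      then obtain d where "d > 0"
        and d: "\<And>z. z \<in> X \<Longrightarrow> dist z (y i) < d \<Longrightarrow>
          dist ((T ^^ k) z) ((T ^^ k) (y i)) < e - dist ((T ^^ k) (y i)) (y i)"
        using continuous_on_funpow[OF cont T, of k] y[OF i] unfolding continuous_on_iff by metis
      show "\<exists>d>0. \<forall>z\<in>X. dist z (y i) < d \<longrightarrow> dist ((T ^^ k) z) (y i) < e"
      proof (intro exI conjI ballI impI)
        fix z assume "z \<in> X" "dist z (y i) < d"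
        from d[OF this] show "dist ((T ^^ k) z) (y i) < e"
          using dist_triangle[of "(T ^^ k) z" "y i" "(T ^^ k) (y i)"] by linarith
      qed fact
    qed
    then obtain d where d: "\<And>i. i \<in> I \<Longrightarrow> d i > 0"
      "\<And>i z. i \<in> I \<Longrightarrow> z \<in> X \<Longrightarrow> dist z (y i) < d i \<Longrightarrow> dist ((T ^^ k) z) (y i) < e"
      by metis
    \<comment> \<open>Inserting e makes the radii decrease and covers empty I.\<close>
    define e' where "e' = Min (insert e (d ` I))"
    have "e' > 0" "e' \<le> e" "\<And>i. i \<in> I \<Longrightarrow> e' \<le> d i"
      unfolding e'_def using I d(1) e by auto
    then have "G k e e'"
      unfolding G_def using k d(2) by (meson less_le_trans)
    with \<open>e' > 0\<close> show ?thesis by auto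
  qed
  \<comment> \<open>The clause for n = 0 pins the first radius to \<epsilon>, so that
    \<open>W 0\<close> is the required ball.\<close>
  then have "\<exists>E. \<forall>n. (E n > 0 \<and> (n = 0 \<longrightarrow> E n = \<epsilon>)) \<and> (\<exists>k. G k (E n) (E (Suc n)))"
    using \<open>\<epsilon> > 0\<close>
    by (intro dependent_nat_choice[where P = "\<lambda>n e. e > 0 \<and> (n = 0 \<longrightarrow> e = \<epsilon>)"
          and Q = "\<lambda>n e e'. \<exists>k. G k e e'"]) auto
  then obtain E where E0: "E 0 = \<epsilon>" and "\<And>n. \<exists>k. G k (E n) (E (Suc n))"
    by blast
  then obtain p where p: "\<And>n. G (p n) (E n) (E (Suc n))" by metis
  have E_dec: "decseq E"
    using p by (intro decseq_SucI) (auto simp: G_def)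
  show thesis
  proof (rule that[of p])
    show "p i \<ge> 1" for i using p[of i] by (simp add: G_def)
    fix \<alpha> :: "nat set" and i
    assume \<alpha>: "finite \<alpha>" "\<alpha> \<noteq> {}" and i: "i \<in> I"
    define W where "W n = {z \<in> X. dist z (y i) < E n}" for n
    have "(T ^^ sum p \<alpha>) (x i) \<in> W 0"
    proof (rule funpow_sum_nested[OF _ _ _ \<alpha>])
      show "(T ^^ p k) z \<in> W k" if "z \<in> W (Suc k)" for k z
        using that p[of k] i funpow_mem[OF T] unfolding W_def G_def by auto
      show "decseq W"
        using E_dec unfolding W_def decseq_def by (fastforce intro: less_le_trans)
      show "(T ^^ p k) (x i) \<in> W k" for k
        using p[of k] i funpow_mem[OF T x[OF i]] unfolding W_def G_def by auto
    qed
    then show "dist ((T ^^ sum p \<alpha>) (x i)) (y i) < \<epsilon>"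
      by (simp add: W_def E0)
  qed
qed

text \<open>Finite sums of a tail of p form an IP-set, so one of them is a return time of any given
  non-empty open V, and V shrinks to the points of V that return to V at that time. Iterating over
  successive index blocks gives q, and z is a common point of the closures of the shrinking sets,
  whence the closures in the conclusion.\<close>

lemma IP_star_central_point:
  fixes X :: "'a::metric_space set" and p :: "nat \<Rightarrow> nat"
  assumes X: "compact X" and cont: "continuous_on X T" and T: "T ` X \<subseteq> X"
    and central: "IP_star_central X T"
    and U: "openin (top_of_set X) U" "U \<noteq> {}"
    and p: "\<And>i. p i \<ge> 1"
  obtains z and q :: "nat \<Rightarrow> nat" where "z \<in> closure U" "\<And>i. q i \<ge> 1"
    "\<And>\<beta>. finite \<beta> \<Longrightarrow> \<beta> \<noteq> {} \<Longrightarrow> \<exists>\<alpha>. finite \<alpha> \<and> \<alpha> \<noteq> {} \<and> sum q \<beta> = sum p \<alpha>"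
    "\<And>\<beta>. finite \<beta> \<Longrightarrow> \<beta> \<noteq> {} \<Longrightarrow> (T ^^ sum q \<beta>) z \<in> closure U"
proof -
  \<comment> \<open>A state is an open set together with the first index of p not yet used
    up.\<close>
  define P where "P n s \<longleftrightarrow> openin (top_of_set X) (fst s) \<and> fst s \<noteq> {} \<and> (n = 0 \<longrightarrow> fst s = U)"
    for n :: nat and s :: "'a set \<times> nat"
  define Q where "Q s s' \<alpha> \<longleftrightarrow> finite \<alpha> \<and> \<alpha> \<noteq> {} \<and> \<alpha> \<subseteq> {snd s..<snd s'} \<and> snd s \<le> snd s' \<and>
      fst s' \<subseteq> fst s \<and> (T ^^ sum p \<alpha>) ` fst s' \<subseteq> fst s"
    for s s' :: "'a set \<times> nat" and \<alpha> :: "nat set"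
  have "\<exists>s'. P (Suc n) s' \<and> (\<exists>\<alpha>. Q s s' \<alpha>)" if P: "P n s" for n s
  proof -
    obtain V m where s: "s = (V, m)" by (cases s)
    have V: "openin (top_of_set X) V" "V \<noteq> {}" using P by (auto simp: P_def s)
    then have VX: "V \<subseteq> X" using openin_imp_subset by blast
    have "IP_set {sum p \<alpha> |\<alpha>. finite \<alpha> \<and> \<alpha> \<noteq> {} \<and> \<alpha> \<subseteq> {m..}}" (is "IP_set ?F")
      unfolding IP_set_def
    proof (intro conjI exI[of _ "\<lambda>i. p (i + m)"] allI impI)
      have "sum p \<alpha> \<ge> 1" if "finite \<alpha>" "\<alpha> \<noteq> {}" for \<alpha>
        using that p by (metis One_nat_def Suc_le_eq sum_pos)
      then show "?F \<subseteq> {1..}" by auto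
      show "p (i + m) \<ge> 1" for i by (rule p)
      fix \<alpha> :: "nat set" assume \<alpha>: "finite \<alpha> \<and> \<alpha> \<noteq> {} \<and> \<alpha> \<subseteq> {1..}"
      have "(\<Sum>i\<in>\<alpha>. p (i + m)) = sum p ((\<lambda>i. i + m) ` \<alpha>)"
        by (simp add: sum.reindex)
      then show "(\<Sum>i\<in>\<alpha>. p (i + m)) \<in> ?F"
        using \<alpha> by (intro CollectI exI[of _ "(\<lambda>i. i + m) ` \<alpha>"]) auto
    qed
    moreover have "IP_star_set (return_times X T V V)"
      using central V by (auto simp: IP_star_central_def)
    ultimately have "return_times X T V V \<inter> ?F \<noteq> {}"
      unfolding IP_star_set_def by blast
    then obtain \<alpha> where \<alpha>: "finite \<alpha>" "\<alpha> \<noteq> {}" "\<alpha> \<subseteq> {m..}" "sum p \<alpha> \<in> return_times X T V V"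
      by blast
    define V' where "V' = V \<inter> {x \<in> X. (T ^^ sum p \<alpha>) x \<in> V}"
    have "continuous_map (top_of_set X) (top_of_set X) (T ^^ sum p \<alpha>)"
      using continuous_on_funpow[OF cont T] funpow_mem[OF T]
      by (auto simp: continuous_map_in_subtopology)
    then have "openin (top_of_set X) {x \<in> topspace (top_of_set X). (T ^^ sum p \<alpha>) x \<in> V}"
      using V(1) by (rule openin_continuous_map_preimage)
    then have "openin (top_of_set X) V'"
      unfolding V'_def using V(1) by (intro openin_Int) auto
    moreover have "V' \<noteq> {}" using \<alpha>(4) by (simp add: V'_def return_times_def)
    \<comment> \<open>The next block starts after \<open>Max \<alpha>\<close>, so blocks of
      different stages are disjoint.\<close>
    ultimately have "P (Suc n) (V', Suc (Max \<alpha>))" by (simp add: P_def)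
    moreover have "m \<le> Max \<alpha>" using \<alpha> by (meson Max_in atLeast_iff subsetD)
    then have "Q s (V', Suc (Max \<alpha>)) \<alpha>"
      using \<alpha> by (auto simp: Q_def s V'_def less_Suc_eq_le)
    ultimately show ?thesis by blast
  qed
  moreover have "\<exists>s. P 0 s" using U by (auto simp: P_def)
  ultimately have "\<exists>s. \<forall>n. P n (s n) \<and> (\<exists>\<alpha>. Q (s n) (s (Suc n)) \<alpha>)"
    by (intro dependent_nat_choice[where Q = "\<lambda>n s s'. \<exists>\<alpha>. Q s s' \<alpha>"]) auto
  then obtain s where s: "\<And>n. P n (s n)" and "\<And>n. \<exists>\<alpha>. Q (s n) (s (Suc n)) \<alpha>" by blast
  then obtain \<alpha> where \<alpha>: "\<And>n. Q (s n) (s (Suc n)) (\<alpha> n)" by metis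
  define q where "q n = sum p (\<alpha> n)" for n
  define W where "W n = closure (fst (s n))" for n
  have sX: "fst (s n) \<subseteq> X" for n using s[of n] openin_imp_subset by (auto simp: P_def)
  have WX: "W n \<subseteq> X" for n
    unfolding W_def using sX compact_imp_closed[OF X] by (rule closure_minimal)
  have W0: "W 0 = closure U" using s[of 0] by (simp add: W_def P_def)
  have W_dec: "decseq W"
    using \<alpha> unfolding W_def by (intro decseq_SucI closure_mono) (auto simp: Q_def)
  have step: "(T ^^ q n) z \<in> W n" if "z \<in> W (Suc n)" for n z
  proof -
    have "(T ^^ q n) ` closure (fst (s (Suc n))) \<subseteq> W n"
    proof (rule image_closure_subset)
      show "continuous_on (closure (fst (s (Suc n)))) (T ^^ q n)"
        using continuous_on_subset[OF continuous_on_funpow[OF cont T] WX[of "Suc n"]]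
        by (simp add: W_def)
      have "(T ^^ q n) ` fst (s (Suc n)) \<subseteq> fst (s n)" using \<alpha>[of n] by (simp add: Q_def q_def)
      then show "(T ^^ q n) ` fst (s (Suc n)) \<subseteq> W n"
        unfolding W_def using closure_subset by blast
    qed (simp add: W_def)
    then show ?thesis using that by (auto simp: W_def)
  qed
  have "(\<Inter>n. W n) \<noteq> {}"
  proof (rule compact_space_imp_nest[OF _ _ _ W_dec])
    show "compact_space (top_of_set X)" using X by (simp add: compact_space_subtopology)
    show "closedin (top_of_set X) (W n)" for n
      using WX by (intro closed_subset) (auto simp: W_def)
    show "W n \<noteq> {}" for n using s[of n] by (simp add: W_def P_def)
  qed
  then obtain z where z: "\<And>n. z \<in> W n" by auto
  have m_mono: "snd (s i) \<le> snd (s j)" if "i \<le> j" for i j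
    using lift_Suc_mono_le[of "\<lambda>i. snd (s i)", OF _ that] \<alpha> by (auto simp: Q_def)
  have disj: "\<alpha> i \<inter> \<alpha> j = {}" if "i < j" for i j
  proof -
    have "\<alpha> i \<subseteq> {..<snd (s (Suc i))}" "\<alpha> j \<subseteq> {snd (s j)..}"
      using \<alpha>[of i] \<alpha>[of j] by (auto simp: Q_def)
    moreover have "{..<snd (s (Suc i))} \<inter> {snd (s j)..} = {}"
      using m_mono[of "Suc i" j] that by auto
    ultimately show ?thesis by blast
  qed
  show thesis
  proof (rule that[of z q])
    show "z \<in> closure U" using z[of 0] W0 by simp
    show "q i \<ge> 1" for i
      using \<alpha>[of i] p sum_pos[of "\<alpha> i" p] by (auto simp: Q_def q_def Suc_le_eq)
    fix \<beta> :: "nat set" assume \<beta>: "finite \<beta>" "\<beta> \<noteq> {}"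
    show "(T ^^ sum q \<beta>) z \<in> closure U"
      using funpow_sum_nested[OF step W_dec _ \<beta>] step z W0 by blast
    \<comment> \<open>By disjointness of the blocks, every finite sum of q is a finite sum of
      p.\<close>
    have "sum p (\<Union>i\<in>\<beta>. \<alpha> i) = (\<Sum>i\<in>\<beta>. sum p (\<alpha> i))"
    proof (rule sum.UNION_disjoint)
      show "\<forall>i\<in>\<beta>. finite (\<alpha> i)" using \<alpha> by (simp add: Q_def)
      show "\<forall>i\<in>\<beta>. \<forall>j\<in>\<beta>. i \<noteq> j \<longrightarrow> \<alpha> i \<inter> \<alpha> j = {}"
        using disj by (metis Int_commute linorder_neqE_nat)
    qed (rule \<beta>(1))
    then show "\<exists>\<alpha>. finite \<alpha> \<and> \<alpha> \<noteq> {} \<and> sum q \<beta> = sum p \<alpha>"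
      using \<beta> \<alpha> by (intro exI[of _ "\<Union>i\<in>\<beta>. \<alpha> i"]) (auto simp: Q_def q_def)
  qed
qed

section \<open>The two implications\<close>

text \<open>The closed ball leaves room for limit points: the closure of the open ball of radius r
  in X still lies in U.\<close>

lemma openin_contains_small_ball:
  fixes X :: "'a::metric_space set"
  assumes "openin (top_of_set X) U" "U \<noteq> {}" "e > 0"
  obtains a r where "a \<in> U" "0 < r" "r \<le> e" "X \<inter> cball a r \<subseteq> U"
proof -
  obtain a where a: "a \<in> U" using assms by auto
  then obtain r where "r > 0" "cball a r \<inter> X \<subseteq> U"
    using assms(1) unfolding openin_contains_cball by blast
  then show thesis using a \<open>e > 0\<close> by (intro that[of a "min r e"]) auto
qed

lemma IP_setE:
  assumes "IP_set F"
  obtains p :: "nat \<Rightarrow> nat" where "\<forall>i\<ge>1. p i \<ge> 1"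
    "\<forall>\<alpha>. finite \<alpha> \<and> \<alpha> \<noteq> {} \<and> \<alpha> \<subseteq> {1..} \<longrightarrow> sum p \<alpha> \<in> F"
  using assms unfolding IP_set_def by (elim conjE exE) (rule that)

text \<open>Take the idempotent u for the given IP-set. The points u (x i) inherit the separation
  \<delta>, while the x i are within \<delta>/3 of each other, so at most one x i is within
  \<delta>/3 of its image. Dropping it leaves m points; u u = u makes them strongly proximal to
  their images.\<close>

lemma proximal_of_sensitive:
  fixes X :: "'a::metric_space set"
  assumes X: "compact X" and cont: "continuous_on X T" and T: "T ` X \<subseteq> X" and "\<delta> > 0"
    and U: "U \<subseteq> X" "\<forall>a\<in>U. \<forall>b\<in>U. dist a b < \<delta> / 3"
    and x: "x \<in> {1..Suc m} \<rightarrow>\<^sub>E U"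
    and IP: "IP_set {k. k \<ge> 1 \<and>
      (\<forall>i\<in>{1..Suc m}. \<forall>j\<in>{1..Suc m}. i < j \<longrightarrow> dist ((T ^^ k) (x i)) ((T ^^ k) (x j)) > \<delta>)}"
  obtains x' y where "x' \<in> {1..m} \<rightarrow>\<^sub>E U" "y \<in> {1..m} \<rightarrow>\<^sub>E X"
    "\<forall>i\<in>{1..m}. \<forall>j\<in>{1..m}. i < j \<longrightarrow> dist (y i) (y j) > \<delta> / 3"
    "\<forall>i\<in>{1..m}. dist (x' i) (y i) > \<delta> / 3"
    "strongly_proximal (power_top m X) (power_map m T) x' y"
proof -
  let ?I = "{1..Suc m}"
  obtain p :: "nat \<Rightarrow> nat" where p: "\<forall>i\<ge>1. p i \<ge> 1"
    and sums: "\<forall>\<alpha>. finite \<alpha> \<and> \<alpha> \<noteq> {} \<and> \<alpha> \<subseteq> {1..} \<longrightarrow> sum p \<alpha> \<in> {k. k \<ge> 1 \<and>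
      (\<forall>i\<in>?I. \<forall>j\<in>?I. i < j \<longrightarrow> dist ((T ^^ k) (x i)) ((T ^^ k) (x j)) > \<delta>)}"
    by (rule IP_setE[OF IP]) (rule that)
  have sep: "dist ((T ^^ sum p \<alpha>) (x i)) ((T ^^ sum p \<alpha>) (x j)) > \<delta>"
    if "finite \<alpha>" "\<alpha> \<noteq> {}" "\<alpha> \<subseteq> {1..}" "i \<in> ?I" "j \<in> ?I" "i < j" for \<alpha> i j
    using sums[rule_format, of \<alpha>] that by simp
  obtain u where uX: "\<forall>z\<in>X. u z \<in> X" and uu: "\<forall>z\<in>X. u (u z) = u z"
    and u: "\<forall>F \<epsilon> N. finite F \<and> F \<subseteq> X \<and> \<epsilon> > 0 \<longrightarrow>
      (\<exists>\<alpha>. finite \<alpha> \<and> \<alpha> \<noteq> {} \<and> \<alpha> \<subseteq> {1..} \<and> sum p \<alpha> \<ge> N \<and> (\<forall>z\<in>F. dist ((T ^^ sum p \<alpha>) z) (u z) < \<epsilon>))"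
    by (rule IP_idempotent_limit[OF X cont T p]) (rule that)
  have xU: "x i \<in> U" if "i \<in> ?I" for i using x that by blast
  then have xX: "x i \<in> X" if "i \<in> ?I" for i using U(1) that by blast
  \<comment> \<open>A single \<alpha> approximates both images within e/2; the strict bound becomes
    weak in the limit.\<close>
  have sep_less: "dist (u (x i)) (u (x j)) \<ge> \<delta>" if ij: "i \<in> ?I" "j \<in> ?I" "i < j" for i j
  proof (rule field_le_epsilon)
    fix e :: real assume "e > 0"
    then obtain \<alpha> where \<alpha>: "finite \<alpha>" "\<alpha> \<noteq> {}" "\<alpha> \<subseteq> {1..}"
      and d: "\<forall>z\<in>{x i, x j}. dist ((T ^^ sum p \<alpha>) z) (u z) < e / 2"
      using u[rule_format, of "{x i, x j}" "e / 2" 0] xX ij by auto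
    then show "\<delta> \<le> dist (u (x i)) (u (x j)) + e"
      using sep[OF \<alpha> ij]
        dist_triangle[of "(T ^^ sum p \<alpha>) (x i)" "(T ^^ sum p \<alpha>) (x j)" "u (x i)"]
        dist_triangle[of "u (x i)" "(T ^^ sum p \<alpha>) (x j)" "u (x j)"]
        dist_commute[of "u (x j)" "(T ^^ sum p \<alpha>) (x j)"]
      by simp
  qed
  have sep_u: "dist (u (x i)) (u (x j)) \<ge> \<delta>" if "i \<in> ?I" "j \<in> ?I" "i \<noteq> j" for i j
    using sep_less[of i j] sep_less[of j i] that by (cases "i < j") (auto simp: dist_commute)
  \<comment> \<open>Otherwise the path through x i and x j joins the two images by three distances
    of at most \<delta>/3, the middle one strictly smaller.\<close>
  have near_unique: "i = j" if ij: "i \<in> ?I" "j \<in> ?I"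
    and "dist (x i) (u (x i)) \<le> \<delta> / 3" "dist (x j) (u (x j)) \<le> \<delta> / 3" for i j
  proof (rule ccontr)
    assume "i \<noteq> j"
    then show False
      using sep_u[OF ij] that(3,4) U(2)[rule_format, OF xU[OF ij(1)] xU[OF ij(2)]]
        dist_triangle[of "u (x i)" "u (x j)" "x i"] dist_triangle[of "x i" "u (x j)" "x j"]
        dist_commute[of "u (x i)" "x i"]
      by linarith
  qed
  \<comment> \<open>The exceptional index if there is one, otherwise arbitrary, possibly outside
    \<open>?I\<close>.\<close>
  obtain i0 where i0: "\<And>i. i \<in> ?I \<Longrightarrow> i \<noteq> i0 \<Longrightarrow> dist (x i) (u (x i)) > \<delta> / 3"
    using near_unique by (metis not_le_imp_less)
  \<comment> \<open>An increasing map of \<open>{1..m}\<close> into \<open>?I\<close> that skips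
    \<open>i0\<close>.\<close>
  define \<sigma> where "\<sigma> i = (if i < i0 then i else Suc i)" for i
  have \<sigma>: "\<sigma> i \<in> ?I" "\<sigma> i \<noteq> i0" if "i \<in> {1..m}" for i using that by (auto simp: \<sigma>_def)
  have \<sigma>_inj: "\<sigma> i \<noteq> \<sigma> j" if "i < j" for i j using that by (auto simp: \<sigma>_def)
  define x' where "x' = (\<lambda>i\<in>{1..m}. x (\<sigma> i))"
  define y where "y = (\<lambda>i\<in>{1..m}. u (x (\<sigma> i)))"
  have x'U: "x' \<in> {1..m} \<rightarrow>\<^sub>E U" and yX: "y \<in> {1..m} \<rightarrow>\<^sub>E X"
    using \<sigma>(1) xU xX uX by (auto simp: x'_def y_def)
  have x'X: "x' \<in> {1..m} \<rightarrow>\<^sub>E X" using x'U U(1) by blast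
  show thesis
  proof (rule that[OF x'U yX])
    show "\<forall>i\<in>{1..m}. \<forall>j\<in>{1..m}. i < j \<longrightarrow> dist (y i) (y j) > \<delta> / 3"
    proof (intro ballI impI)
      fix i j assume "i \<in> {1..m}" "j \<in> {1..m}" "i < j"
      then show "dist (y i) (y j) > \<delta> / 3"
        using sep_u[OF \<sigma>(1) \<sigma>(1) \<sigma>_inj, of i j] \<open>\<delta> > 0\<close> by (simp add: y_def)
    qed
    show "\<forall>i\<in>{1..m}. dist (x' i) (y i) > \<delta> / 3"
      using i0 \<sigma> by (simp add: x'_def y_def)
    show "strongly_proximal (power_top m X) (power_map m T) x' y"
      unfolding strongly_proximal_power_iff[OF T x'X yX]
    proof (intro allI impI)
      fix \<epsilon> :: real and N :: nat assume "\<epsilon> > 0"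
      moreover have "x' ` {1..m} \<union> y ` {1..m} \<subseteq> X" using x'X yX by blast
      ultimately obtain \<alpha> where "sum p \<alpha> \<ge> N"
        and d: "\<forall>z \<in> x' ` {1..m} \<union> y ` {1..m}. dist ((T ^^ sum p \<alpha>) z) (u z) < \<epsilon>"
        using u[rule_format, of "x' ` {1..m} \<union> y ` {1..m}" \<epsilon> N] by auto
      \<comment> \<open>Idempotence enters here: the same time brings both x' i and y i close to y
        i.\<close>
      have "u (x' i) = y i" "u (y i) = y i" if "i \<in> {1..m}" for i
        using that bspec[OF uu xX[OF \<sigma>(1)]] by (simp_all add: x'_def y_def)
      with d \<open>sum p \<alpha> \<ge> N\<close> show "\<exists>k\<ge>N. \<forall>i\<in>{1..m}.
          dist ((T ^^ k) (x' i)) (y i) < \<epsilon> \<and> dist ((T ^^ k) (y i)) (y i) < \<epsilon>"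
        by (intro exI[of _ "sum p \<alpha>"]) (metis UnI1 UnI2 imageI)
    qed
  qed
qed

text \<open>Along an IP-set the x i come near the separated y i. Passing to a sub-IP-set, a further
  point z keeps returning to the closed r-ball around a, hence near the x i and away from the y i;
  it becomes the last entry of the tuple.\<close>

lemma sensitive_of_proximal:
  fixes X :: "'a::metric_space set"
  assumes X: "compact X" and cont: "continuous_on X T" and T: "T ` X \<subseteq> X" and "\<delta> > 0"
    and central: "IP_star_central X T"
    and U: "X \<inter> cball a r \<subseteq> U" "a \<in> X" "0 < r" "r \<le> \<delta> / 8"
    and x: "x \<in> {1..m} \<rightarrow>\<^sub>E X \<inter> ball a r" and y: "y \<in> {1..m} \<rightarrow>\<^sub>E X"
    and yy: "\<forall>i\<in>{1..m}. \<forall>j\<in>{1..m}. i < j \<longrightarrow> dist (y i) (y j) > \<delta>"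
    and xy: "\<forall>i\<in>{1..m}. dist (x i) (y i) > \<delta>"
    and prox: "strongly_proximal (power_top m X) (power_map m T) x y"
  shows "\<exists>x' \<in> {1..Suc m} \<rightarrow>\<^sub>E U. IP_set {k. k \<ge> 1 \<and>
    (\<forall>i\<in>{1..Suc m}. \<forall>j\<in>{1..Suc m}. i < j \<longrightarrow> dist ((T ^^ k) (x' i)) ((T ^^ k) (x' j)) > \<delta> / 2)}"
proof -
  let ?W = "X \<inter> ball a r"
  have xX: "x \<in> {1..m} \<rightarrow>\<^sub>E X" using x by blast
  obtain p :: "nat \<Rightarrow> nat" where p: "\<And>i. p i \<ge> 1"
    and px: "\<And>\<alpha> i. finite \<alpha> \<Longrightarrow> \<alpha> \<noteq> {} \<Longrightarrow> i \<in> {1..m} \<Longrightarrow> dist ((T ^^ sum p \<alpha>) (x i)) (y i) < \<delta> / 4"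
  proof (rule proximal_IP[OF cont T, of "{1..m}" x y "\<delta> / 4"])
    show "\<exists>k\<ge>1. \<forall>i\<in>{1..m}. dist ((T ^^ k) (x i)) (y i) < \<epsilon> \<and> dist ((T ^^ k) (y i)) (y i) < \<epsilon>"
      if "\<epsilon> > 0" for \<epsilon>
      using prox that unfolding strongly_proximal_power_iff[OF T xX y] by blast
  qed (use xX y \<open>\<delta> > 0\<close> in auto)
  have W: "openin (top_of_set X) ?W" "?W \<noteq> {}" using U by auto
  \<comment> \<open>As sums of q are sums of p, the estimate \<open>px\<close> survives the passage
    from p to q.\<close>
  obtain z and q :: "nat \<Rightarrow> nat" where z: "z \<in> closure ?W" and q: "\<And>i. q i \<ge> 1"
    and qp: "\<And>\<beta>. finite \<beta> \<Longrightarrow> \<beta> \<noteq> {} \<Longrightarrow> \<exists>\<alpha>. finite \<alpha> \<and> \<alpha> \<noteq> {} \<and> sum q \<beta> = sum p \<alpha>"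
    and qz: "\<And>\<beta>. finite \<beta> \<Longrightarrow> \<beta> \<noteq> {} \<Longrightarrow> (T ^^ sum q \<beta>) z \<in> closure ?W"
    by (rule IP_star_central_point[where p = p, OF X cont T central W p]) (rule that; simp)
  have clW: "closure ?W \<subseteq> X \<inter> cball a r"
    using compact_imp_closed[OF X] by (intro closure_minimal) auto
  define x' where "x' = x(Suc m := z)"
  have x': "x' i = x i" if "i \<in> {1..m}" for i using that by (simp add: x'_def)
  have sep: "dist ((T ^^ sum q \<beta>) (x' i)) ((T ^^ sum q \<beta>) (x' j)) > \<delta> / 2"
    if \<beta>: "finite \<beta>" "\<beta> \<noteq> {}" and ij: "i \<in> {1..Suc m}" "j \<in> {1..Suc m}" "i < j" for \<beta> i j
  proof -
    let ?k = "sum q \<beta>"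
    have i: "i \<in> {1..m}" using ij by auto
    have near: "dist ((T ^^ ?k) (x l)) (y l) < \<delta> / 4" if "l \<in> {1..m}" for l
      using qp[OF \<beta>] px that by metis
    show ?thesis
    proof (cases "j = Suc m")
      case True
      \<comment> \<open>The budget: from d(x i, y i) > \<delta> subtract 2r, at most \<delta>/4, for
        the detour through a, and \<delta>/4 for the distance to y i; more than \<delta>/2
        remains.\<close>
      have "dist a ((T ^^ ?k) z) \<le> r" using qz[OF \<beta>] clW by auto
      moreover have "dist a (x i) < r" using x i by (auto dest: PiE_mem)
      moreover have "dist (x i) (y i) > \<delta>" using xy i by blast
      ultimately have "dist ((T ^^ ?k) (x i)) ((T ^^ ?k) z) > \<delta> / 2"
        using near[OF i] U(4) dist_triangle[of "x i" "y i" a]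
          dist_triangle[of a "y i" "(T ^^ ?k) z"] dist_triangle[of "(T ^^ ?k) z" "y i" "(T ^^ ?k) (x i)"]
        by (simp add: dist_commute)
      then show ?thesis using True x'[OF i] by (simp add: x'_def)
    next
      case False
      then have j: "j \<in> {1..m}" using ij by auto
      \<comment> \<open>Here \<delta>/4 is lost at each end.\<close>
      then have "dist (y i) (y j) > \<delta>" using yy i ij by blast
      then have "dist ((T ^^ ?k) (x i)) ((T ^^ ?k) (x j)) > \<delta> / 2"
        using near[OF i] near[OF j] dist_triangle[of "y i" "y j" "(T ^^ ?k) (x i)"]
          dist_triangle[of "(T ^^ ?k) (x i)" "y j" "(T ^^ ?k) (x j)"]
        by (simp add: dist_commute)
      then show ?thesis using x'[OF i] x'[OF j] by simp
    qed
  qed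
  show ?thesis
  proof
    have "?W \<subseteq> U" using U(1) by (meson Int_mono ball_subset_cball dual_order.trans order_refl)
    then have "x \<in> {1..m} \<rightarrow>\<^sub>E U" using x by blast
    moreover have "z \<in> U" using z clW U(1) by blast
    ultimately show "x' \<in> {1..Suc m} \<rightarrow>\<^sub>E U"
      by (auto simp: x'_def PiE_iff extensional_def)
    show "IP_set {k. k \<ge> 1 \<and> (\<forall>i\<in>{1..Suc m}. \<forall>j\<in>{1..Suc m}. i < j \<longrightarrow>
        dist ((T ^^ k) (x' i)) ((T ^^ k) (x' j)) > \<delta> / 2)}"
      unfolding IP_set_def
    proof (intro conjI exI[of _ q] allI impI)
      fix \<beta> :: "nat set" assume \<beta>: "finite \<beta> \<and> \<beta> \<noteq> {} \<and> \<beta> \<subseteq> {1..}"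
      then have "sum q \<beta> \<ge> 1" using q by (metis One_nat_def Suc_le_eq sum_pos)
      with \<beta> sep show "sum q \<beta> \<in> {k. k \<ge> 1 \<and> (\<forall>i\<in>{1..Suc m}. \<forall>j\<in>{1..Suc m}. i < j \<longrightarrow>
        dist ((T ^^ k) (x' i)) ((T ^^ k) (x' j)) > \<delta> / 2)}" by blast
    qed (use q in auto)
  qed
qed

theorem proposition3p3:
  fixes X :: "'a::metric_space set" and T :: "'a \<Rightarrow> 'a" and n :: nat
  assumes "dynamical_system X T" and "IP_star_central X T" and "n \<ge> 2"
  shows "tuplewise_IP_sensitive n X T \<longleftrightarrow>
    (\<exists>\<delta>>0. \<forall>U. openin (top_of_set X) U \<and> U \<noteq> {} \<longrightarrow>
      (\<exists>x \<in> {1..n-1} \<rightarrow>\<^sub>E U. \<exists>y \<in> {1..n-1} \<rightarrow>\<^sub>E X.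
        (\<forall>i\<in>{1..n-1}. \<forall>j\<in>{1..n-1}. i < j \<longrightarrow> dist (y i) (y j) > \<delta>) \<and>
        (\<forall>i\<in>{1..n-1}. dist (x i) (y i) > \<delta>) \<and>
        strongly_proximal (power_top (n-1) X) (power_map (n-1) T) x y))"
    (is "_ \<longleftrightarrow> ?R")
proof -
  have X: "compact X" and cont: "continuous_on X T" and T: "T ` X \<subseteq> X"
    using assms(1) by (auto simp: dynamical_system_def)
  obtain m where n: "n = Suc m" using assms(3) by (cases n) auto
  show ?thesis
  proof
    assume "tuplewise_IP_sensitive n X T"
    then obtain \<delta> where "\<delta> > 0" and sens: "\<And>U. openin (top_of_set X) U \<Longrightarrow> U \<noteq> {} \<Longrightarrow>
        (\<exists>x \<in> {1..n} \<rightarrow>\<^sub>E U. IP_set {k. k \<ge> 1 \<and>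
          (\<forall>i\<in>{1..n}. \<forall>j\<in>{1..n}. i < j \<longrightarrow> dist ((T ^^ k) (x i)) ((T ^^ k) (x j)) > \<delta>)})"
      unfolding tuplewise_IP_sensitive_def by blast
    show ?R
    proof (intro exI[of _ "\<delta> / 3"] conjI allI impI)
      show "\<delta> / 3 > 0" using \<open>\<delta> > 0\<close> by simp
      fix U assume U: "openin (top_of_set X) U \<and> U \<noteq> {}"
      \<comment> \<open>Sensitivity is applied to a small ball instead of U: its points are less
        than 2r apart, within the \<delta>/3 that \<open>proximal_of_sensitive\<close>
        requires.\<close>
      obtain a r where a: "a \<in> U" and r: "0 < r" "r \<le> \<delta> / 8" "X \<inter> cball a r \<subseteq> U"
        using openin_contains_small_ball[of X U "\<delta> / 8"] U \<open>\<delta> > 0\<close> by auto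
      let ?W = "X \<inter> ball a r"
      have "a \<in> X" using a U openin_imp_subset by blast
      then have W: "openin (top_of_set X) ?W" "?W \<noteq> {}" using r by auto
      have WU: "?W \<subseteq> U" using r(3) by (meson Int_mono ball_subset_cball dual_order.trans order_refl)
      have small: "\<forall>b\<in>?W. \<forall>c\<in>?W. dist b c < \<delta> / 3"
      proof (intro ballI)
        fix b c assume "b \<in> ?W" "c \<in> ?W"
        then have "dist b a < r" "dist c a < r" by (simp_all add: dist_commute)
        then show "dist b c < \<delta> / 3" using r dist_triangle2[of b c a] by linarith
      qed
      obtain x where xW: "x \<in> {1..Suc m} \<rightarrow>\<^sub>E ?W" and IP: "IP_set {k. k \<ge> 1 \<and>
          (\<forall>i\<in>{1..Suc m}. \<forall>j\<in>{1..Suc m}. i < j \<longrightarrow> dist ((T ^^ k) (x i)) ((T ^^ k) (x j)) > \<delta>)}"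
        using sens[OF W] unfolding n by (elim bexE) (rule that)
      obtain x' y where "x' \<in> {1..m} \<rightarrow>\<^sub>E ?W" "y \<in> {1..m} \<rightarrow>\<^sub>E X"
        "\<forall>i\<in>{1..m}. \<forall>j\<in>{1..m}. i < j \<longrightarrow> dist (y i) (y j) > \<delta> / 3"
        "\<forall>i\<in>{1..m}. dist (x' i) (y i) > \<delta> / 3"
        "strongly_proximal (power_top m X) (power_map m T) x' y"
        by (rule proximal_of_sensitive[OF X cont T \<open>\<delta> > 0\<close> Int_lower1 small xW IP]) (rule that)
      moreover from this(1) WU have "x' \<in> {1..m} \<rightarrow>\<^sub>E U" by blast
      ultimately show "\<exists>x \<in> {1..n-1} \<rightarrow>\<^sub>E U. \<exists>y \<in> {1..n-1} \<rightarrow>\<^sub>E X.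
        (\<forall>i\<in>{1..n-1}. \<forall>j\<in>{1..n-1}. i < j \<longrightarrow> dist (y i) (y j) > \<delta> / 3) \<and>
        (\<forall>i\<in>{1..n-1}. dist (x i) (y i) > \<delta> / 3) \<and>
        strongly_proximal (power_top (n-1) X) (power_map (n-1) T) x y"
        unfolding n diff_Suc_1 by (intro bexI[of _ x'] bexI[of _ y] conjI)
    qed
  next
    assume ?R
    then obtain \<delta> where "\<delta> > 0" and prox: "\<forall>U. openin (top_of_set X) U \<and> U \<noteq> {} \<longrightarrow>
      (\<exists>x \<in> {1..m} \<rightarrow>\<^sub>E U. \<exists>y \<in> {1..m} \<rightarrow>\<^sub>E X.
        (\<forall>i\<in>{1..m}. \<forall>j\<in>{1..m}. i < j \<longrightarrow> dist (y i) (y j) > \<delta>) \<and>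
        (\<forall>i\<in>{1..m}. dist (x i) (y i) > \<delta>) \<and>
        strongly_proximal (power_top m X) (power_map m T) x y)"
      unfolding n diff_Suc_1 by (elim exE conjE) (rule that)
    show "tuplewise_IP_sensitive n X T"
      unfolding tuplewise_IP_sensitive_def n
    proof (intro exI[of _ "\<delta> / 2"] conjI allI impI)
      show "\<delta> / 2 > 0" using \<open>\<delta> > 0\<close> by simp
      fix U assume U: "openin (top_of_set X) U \<and> U \<noteq> {}"
      obtain a r where a: "a \<in> U" and r: "0 < r" "r \<le> \<delta> / 8" "X \<inter> cball a r \<subseteq> U"
        using openin_contains_small_ball[of X U "\<delta> / 8"] U \<open>\<delta> > 0\<close> by auto
      have aX: "a \<in> X" using a U openin_imp_subset by blast
      \<comment> \<open>Again a small ball replaces U, so that the x i lie close to the returning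
        point.\<close>
      then have W: "openin (top_of_set X) (X \<inter> ball a r) \<and> X \<inter> ball a r \<noteq> {}" using r by auto
      obtain x y where "x \<in> {1..m} \<rightarrow>\<^sub>E X \<inter> ball a r" "y \<in> {1..m} \<rightarrow>\<^sub>E X"
        "\<forall>i\<in>{1..m}. \<forall>j\<in>{1..m}. i < j \<longrightarrow> dist (y i) (y j) > \<delta>"
        "\<forall>i\<in>{1..m}. dist (x i) (y i) > \<delta>"
        "strongly_proximal (power_top m X) (power_map m T) x y"
        using prox[rule_format, OF W] by (elim bexE conjE) (rule that)
      then show "\<exists>x \<in> {1..Suc m} \<rightarrow>\<^sub>E U. IP_set {k. k \<ge> 1 \<and>
          (\<forall>i\<in>{1..Suc m}. \<forall>j\<in>{1..Suc m}. i < j \<longrightarrow> dist ((T ^^ k) (x i)) ((T ^^ k) (x j)) > \<delta> / 2)}"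
        by (rule sensitive_of_proximal[OF X cont T \<open>\<delta> > 0\<close> assms(2) r(3) aX r(1,2)])
    qed
  qed
qed

end
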